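(* Let $(N_1,m_1)\vartriangleright_E(N_2,m_2)$ and let $G=(V,R,A)$ be a well-formed Token Flow Graph for this equivalence. If $m$ is a marking in $R(N_1,m_1)$ or in $R(N_2,m_2)$, then there exists a total, well-defined configuration $c$ of $G$ such that $c\equiv m$. Conversely, if $c$ is a total, well-defined configuration of $G$ and the marking $c_{\mid N_1}$ is reachable in $(N_1,m_1)$, then $c_{\mid N_2}$ is reachable in $(N_2,m_2)$.
   Context: Petri nets. A Petri net is $N=(P,T,\mathbf{pre},\mathbf{post})$ with finite disjoint sets of places $P$ and transitions $T$ and $\mathbf{pre},\mathbf{post}:T\to(P\to\mathbb{N})$. A marking is a map $m:P\to\mathbb{N}$. Transition $t$ is enabled at $m$ if $m(p)\ge\mathbf{pre}(t,p)$ for all $p$; firing it yields $m'=m-\mathbf{pre}(t)+\mathbf{post}(t)$. $R(N,m_0)$ is the set of markings reachable from $m_0$ by finite (possibly empty) sequences of firings. Equations. Solutions of a linear system $E$ (with variable set $\mathrm{fv}(E)$) are total non-negative integer assignments satisfying all equations; $E$ is consistent if it has one. Fix pairwise disjoint sets $K(n)$, $n\in\mathbb{N}$, of constant symbols (disjoint from place and variable names), $K=\bigcup_n K(n)$; a constant in $K(n)$ stands for $n$. Every equation of $E$ has the form $v=\sum_{x\in X}x$ with $X$ a nonempty finite set of variables and $v$ a variable or constant. For a partial map $m$ defined exactly on $x_1,\dots,x_k$, $\llbracket m\rrbracket$ is the system $x_1=m(x_1),\dots,x_k=m(x_k)$; commas denote union of systems. Two partial maps are compatible, $m\equiv m'$,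 if they agree wherever both are defined. $E$-equivalence: $(N_1,m_1)\vartriangleright_E(N_2,m_2)$ iff (A1) $E,\llbracket m\rrbracket$ is consistent for every $m\in R(N_1,m_1)\cup R(N_2,m_2)$; (A2) $E,\llbracket m_1\rrbracket,\llbracket m_2\rrbracket$ is consistent; (A3) for all markings $m_1'$ of $N_1$, $m_2'$ of $N_2$ with $E,\llbracket m_1'\rrbracket,\llbracket m_2'\rrbracket$ consistent, $m_1'\in R(N_1,m_1)$ iff $m_2'\in R(N_2,m_2)$. Token Flow Graphs. A TFG is $(V,R,A)$ with $V=P\cup S$, $S\subset K$ finite, and disjoint $R,A\subseteq V\times V$. Write $v\to\!\bullet\, w$ for $(v,w)\in R$, $v\circ\!\!\to w$ for $(v,w)\in A$, $v\to w$ for either. A root is a node that is the target of no arc. $v\circ\!\!\to X$ means $X$ is the nonempty set of all $w$ with $v\circ\!\!\to w$; $X\to\!\bullet\, v$ means $X$ is the nonempty set of all $w$ with $w\to\!\bullet\, v$. The TFG is well-formed for $(N_1,m_1)\vartriangleright_E(N_2,m_2)$ (place sets $P_1,P_2$) if: (T1) $V\setminus K=P_1\cup P_2\cup\mathrm{fv}(E)$; (T2) nodes in $V\cap K$ are roots; (T3) one cannot have $p\circ\!\!\to q$ and $p'\to q$ with $p\ne p'$, nor both $p\to\!\bullet\, q$ and $p\circ\!\!\to q$; (T4) $v\circ\!\!\to X$ or $X\to\!\bullet\, v$ holds iff the equation $v=\sum_{x\in X}x$ is in $E$. Configurations. A configuration is a partial function $c:V\to\mathbb{N}$ ($c(v)=\bot$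 when undefined) with $c(v)=n$ for all $v\in V\cap K(n)$; it is total if defined everywhere. It is well-defined if (CBot) whenever $v\to w$, $c(v)=\bot$ iff $c(w)=\bot$; and (CEq) whenever $c(v)\ne\bot$ and ($v\circ\!\!\to X$ or $X\to\!\bullet\, v$), $c(v)=\sum_{x\in X}c(x)$. For a net $N$, $c_{\mid N}$ is the restriction of $c$ to the places of $N$ (a marking of $N$ when $c$ is total). *)

theory Defs
  imports Main "HOL-Library.Disjoint_Sets"
begin

text \<open>
  Places, variables and constants are symbols of one type \<open>'v\<close>; the family \<open>K :: nat \<Rightarrow> 'v set\<close>
  singles out the constants, and every symbol outside it may be used as a place or variable name.
  Markings and configurations are partial maps, so that compatibility and restriction apply to both.
\<close>

subsection \<open>Petri nets\<close>

text \<open>Disjointness of places and transitions is ensured by their having different types.\<close>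

record ('v, 't) petri_net =
  places :: "'v set"
  transitions :: "'t set"
  pre :: "'t \<Rightarrow> 'v \<Rightarrow> nat"
  post :: "'t \<Rightarrow> 'v \<Rightarrow> nat"

definition is_petri_net :: "('v, 't) petri_net \<Rightarrow> bool" where
  "is_petri_net N \<longleftrightarrow> finite (places N) \<and> finite (transitions N)"

definition marking :: "('v, 't) petri_net \<Rightarrow> ('v \<rightharpoonup> nat) \<Rightarrow> bool" where
  "marking N m \<longleftrightarrow> dom m = places N"

definition enabled :: "('v, 't) petri_net \<Rightarrow> ('v \<rightharpoonup> nat) \<Rightarrow> 't \<Rightarrow> bool" where
  "enabled N m t \<longleftrightarrow> t \<in> transitions N \<and> (\<forall>p\<in>places N. pre N t p \<le> the (m p))"

definition fire :: "('v, 't) petri_net \<Rightarrow> ('v \<rightharpoonup> nat) \<Rightarrow> 't \<Rightarrow> ('v \<rightharpoonup> nat)" where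
  "fire N m t = (\<lambda>p. if p \<in> places N then Some (the (m p) - pre N t p + post N t p) else None)"

definition step :: "('v, 't) petri_net \<Rightarrow> ('v \<rightharpoonup> nat) \<Rightarrow> ('v \<rightharpoonup> nat) \<Rightarrow> bool" where
  "step N m m' \<longleftrightarrow> (\<exists>t. enabled N m t \<and> m' = fire N m t)"

definition reach :: "('v, 't) petri_net \<Rightarrow> ('v \<rightharpoonup> nat) \<Rightarrow> ('v \<rightharpoonup> nat) set" where
  "reach N m\<^sub>0 = {m. (step N)\<^sup>*\<^sup>* m\<^sub>0 m}"

subsection \<open>Linear systems\<close>

text \<open>
  \<open>Sum_Eq v X\<close> is the equation \<open>v = (\<Sum>x\<in>X. x)\<close>; \<open>Val_Eq x n\<close> is the equation \<open>x = n\<close> with a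
  number on the right, which occurs only in the systems obtained from partial maps.
\<close>

datatype 'v equation = Sum_Eq 'v "'v set" | Val_Eq 'v nat

definition consts_of :: "(nat \<Rightarrow> 'v set) \<Rightarrow> 'v set" where
  "consts_of K = (\<Union>n. K n)"

definition linear_system :: "(nat \<Rightarrow> 'v set) \<Rightarrow> 'v equation set \<Rightarrow> bool" where
  "linear_system K E \<longleftrightarrow> finite E \<and>
     (\<forall>e\<in>E. \<exists>v X. e = Sum_Eq v X \<and> X \<noteq> {} \<and> finite X \<and> X \<inter> consts_of K = {})"

fun symbols :: "'v equation \<Rightarrow> 'v set" where
  "symbols (Sum_Eq v X) = insert v X"
| "symbols (Val_Eq x n) = {x}"

definition fv :: "(nat \<Rightarrow> 'v set) \<Rightarrow> 'v equation set \<Rightarrow> 'v set" where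
  "fv K E = (\<Union>e\<in>E. symbols e) - consts_of K"

definition value_of :: "(nat \<Rightarrow> 'v set) \<Rightarrow> ('v \<Rightarrow> nat) \<Rightarrow> 'v \<Rightarrow> nat" where
  "value_of K \<sigma> v = (if v \<in> consts_of K then (THE n. v \<in> K n) else \<sigma> v)"

fun satisfies :: "(nat \<Rightarrow> 'v set) \<Rightarrow> ('v \<Rightarrow> nat) \<Rightarrow> 'v equation \<Rightarrow> bool" where
  "satisfies K \<sigma> (Sum_Eq v X) \<longleftrightarrow> value_of K \<sigma> v = (\<Sum>x\<in>X. value_of K \<sigma> x)"
| "satisfies K \<sigma> (Val_Eq x n) \<longleftrightarrow> value_of K \<sigma> x = n"

definition solution :: "(nat \<Rightarrow> 'v set) \<Rightarrow> 'v equation set \<Rightarrow> ('v \<Rightarrow> nat) \<Rightarrow> bool" where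
  "solution K E \<sigma> \<longleftrightarrow> (\<forall>e\<in>E. satisfies K \<sigma> e)"

definition consistent :: "(nat \<Rightarrow> 'v set) \<Rightarrow> 'v equation set \<Rightarrow> bool" where
  "consistent K E \<longleftrightarrow> (\<exists>\<sigma>. solution K E \<sigma>)"

definition map_system :: "('v \<rightharpoonup> nat) \<Rightarrow> 'v equation set"  (\<open>\<lbrakk>_\<rbrakk>\<close>) where
  "\<lbrakk>m\<rbrakk> = {Val_Eq x n | x n. m x = Some n}"

definition compatible :: "('v \<rightharpoonup> nat) \<Rightarrow> ('v \<rightharpoonup> nat) \<Rightarrow> bool" where
  "compatible m m' \<longleftrightarrow> (\<forall>x \<in> dom m \<inter> dom m'. m x = m' x)"

definition E_equivalent ::
  "(nat \<Rightarrow> 'v set) \<Rightarrow> 'v equation set \<Rightarrow>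
   ('v, 's) petri_net \<Rightarrow> ('v \<rightharpoonup> nat) \<Rightarrow> ('v, 't) petri_net \<Rightarrow> ('v \<rightharpoonup> nat) \<Rightarrow> bool" where
  "E_equivalent K E N\<^sub>1 m\<^sub>1 N\<^sub>2 m\<^sub>2 \<longleftrightarrow>
     (\<forall>m \<in> reach N\<^sub>1 m\<^sub>1 \<union> reach N\<^sub>2 m\<^sub>2. consistent K (E \<union> \<lbrakk>m\<rbrakk>)) \<and>
     consistent K (E \<union> \<lbrakk>m\<^sub>1\<rbrakk> \<union> \<lbrakk>m\<^sub>2\<rbrakk>) \<and>
     (\<forall>m\<^sub>1' m\<^sub>2'. marking N\<^sub>1 m\<^sub>1' \<and> marking N\<^sub>2 m\<^sub>2' \<and> consistent K (E \<union> \<lbrakk>m\<^sub>1'\<rbrakk> \<union> \<lbrakk>m\<^sub>2'\<rbrakk>) \<longrightarrow>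
        (m\<^sub>1' \<in> reach N\<^sub>1 m\<^sub>1 \<longleftrightarrow> m\<^sub>2' \<in> reach N\<^sub>2 m\<^sub>2))"

subsection \<open>Token flow graphs\<close>

record 'v tfg =
  nodes :: "'v set"
  red :: "('v \<times> 'v) set"
  agg :: "('v \<times> 'v) set"

definition is_tfg :: "'v tfg \<Rightarrow> bool" where
  "is_tfg G \<longleftrightarrow> finite (nodes G) \<and> red G \<subseteq> nodes G \<times> nodes G \<and> agg G \<subseteq> nodes G \<times> nodes G \<and>
     red G \<inter> agg G = {}"

definition arcs :: "'v tfg \<Rightarrow> ('v \<times> 'v) set" where
  "arcs G = red G \<union> agg G"

definition root :: "'v tfg \<Rightarrow> 'v \<Rightarrow> bool" where
  "root G v \<longleftrightarrow> v \<in> nodes G \<and> (\<forall>w. (w, v) \<notin> arcs G)"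

definition agg_set :: "'v tfg \<Rightarrow> 'v \<Rightarrow> 'v set \<Rightarrow> bool" where
  "agg_set G v X \<longleftrightarrow> X \<noteq> {} \<and> X = {w. (v, w) \<in> agg G}"

definition red_set :: "'v tfg \<Rightarrow> 'v set \<Rightarrow> 'v \<Rightarrow> bool" where
  "red_set G X v \<longleftrightarrow> X \<noteq> {} \<and> X = {w. (w, v) \<in> red G}"

definition well_formed_tfg ::
  "(nat \<Rightarrow> 'v set) \<Rightarrow> 'v tfg \<Rightarrow> 'v equation set \<Rightarrow>
   ('v, 's) petri_net \<Rightarrow> ('v, 't) petri_net \<Rightarrow> bool" where
  "well_formed_tfg K G E N\<^sub>1 N\<^sub>2 \<longleftrightarrow>
     nodes G - consts_of K = places N\<^sub>1 \<union> places N\<^sub>2 \<union> fv K E \<and>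
     (\<forall>v \<in> nodes G \<inter> consts_of K. root G v) \<and>
     (\<forall>p p' q. \<not> ((p, q) \<in> agg G \<and> (p', q) \<in> arcs G \<and> p \<noteq> p')) \<and>
     (\<forall>p q. \<not> ((p, q) \<in> red G \<and> (p, q) \<in> agg G)) \<and>
     (\<forall>v X. agg_set G v X \<or> red_set G X v \<longleftrightarrow> Sum_Eq v X \<in> E)"

subsection \<open>Configurations\<close>

definition configuration :: "(nat \<Rightarrow> 'v set) \<Rightarrow> 'v tfg \<Rightarrow> ('v \<rightharpoonup> nat) \<Rightarrow> bool" where
  "configuration K G c \<longleftrightarrow> dom c \<subseteq> nodes G \<and> (\<forall>n. \<forall>v \<in> nodes G \<inter> K n. c v = Some n)"

definition total_config :: "'v tfg \<Rightarrow> ('v \<rightharpoonup> nat) \<Rightarrow> bool" where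
  "total_config G c \<longleftrightarrow> (\<forall>v \<in> nodes G. c v \<noteq> None)"

text \<open>
  In the second clause all \<open>c x\<close> with \<open>x \<in> X\<close> are defined by the first one, so \<open>the\<close> is harmless.
\<close>

definition well_defined :: "'v tfg \<Rightarrow> ('v \<rightharpoonup> nat) \<Rightarrow> bool" where
  "well_defined G c \<longleftrightarrow>
     (\<forall>v w. (v, w) \<in> arcs G \<longrightarrow> (c v = None \<longleftrightarrow> c w = None)) \<and>
     (\<forall>v X. c v \<noteq> None \<and> (agg_set G v X \<or> red_set G X v) \<longrightarrow> the (c v) = (\<Sum>x\<in>X. the (c x)))"

end

theory Submission
  imports Defs
begin

text \<open>
  By (T4) the equations of \<open>E\<close> are exactly the constraints (CEq), so total well-defined configurations
  of \<open>G\<close> are the restrictions to the nodes of the solutions of \<open>E\<close>. The first claim is then (A1), and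
  the second is (A3) applied to the two restrictions of \<open>c\<close>, which \<open>c\<close> itself shows to be consistent.
\<close>

text \<open>Pairwise disjointness of the classes \<open>K n\<close> is what makes the definite
  description in \<open>value_of\<close> denote a unique number.\<close>

lemma value_of_const:
  assumes "disjoint_family K" and "v \<in> K n"
  shows "value_of K \<sigma> v = n"
proof -
  have "(THE i. v \<in> K i) = n"
    using assms by (intro the_equality) (auto simp: disjoint_family_on_def)
  then show ?thesis
    using assms(2) by (auto simp: value_of_def consts_of_def)
qed

text \<open>A configuration already gives each constant among the nodes its prescribed number, so
  reading it as an assignment changes nothing there. A constant outside the nodes would be read as
  \<open>the None\<close>, hence the restriction to nodes.\<close>

lemma value_of_configuration:
  assumes "disjoint_family K" and "configuration K G c" and "v \<in> nodes G"
  shows "value_of K (\<lambda>v. the (c v)) v = the (c v)"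
proof (cases "v \<in> consts_of K")
  case True
  then obtain n where "v \<in> K n"
    by (auto simp: consts_of_def)
  then show ?thesis
    using assms value_of_const[OF assms(1)] by (auto simp: configuration_def)
qed (simp add: value_of_def)

text \<open>Since \<open>X\<close> is nonempty, some arc has \<open>v\<close> as an endpoint, and
  arcs only join nodes.\<close>

lemma agg_or_red_set_nodes:
  assumes "is_tfg G" and "agg_set G v X \<or> red_set G X v"
  shows "v \<in> nodes G" and "X \<subseteq> nodes G"
  using assms by (auto simp: is_tfg_def agg_set_def red_set_def)

lemma well_formed_tfg_equation_iff:
  assumes "well_formed_tfg K G E N\<^sub>1 N\<^sub>2"
  shows "agg_set G v X \<or> red_set G X v \<longleftrightarrow> Sum_Eq v X \<in> E"
  using assms by (auto simp: well_formed_tfg_def)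

lemma well_formed_tfg_places:
  assumes "well_formed_tfg K G E N\<^sub>1 N\<^sub>2"
  shows "places N\<^sub>1 \<subseteq> nodes G" and "places N\<^sub>2 \<subseteq> nodes G"
  using assms by (auto simp: well_formed_tfg_def)

lemma solution_Un:
  "solution K (E \<union> F) \<sigma> \<longleftrightarrow> solution K E \<sigma> \<and> solution K F \<sigma>"
  by (auto simp: solution_def)

lemma solution_map_system:
  "solution K \<lbrakk>m\<rbrakk> \<sigma> \<longleftrightarrow> (\<forall>x n. m x = Some n \<longrightarrow> value_of K \<sigma> x = n)"
  by (force simp: solution_def map_system_def)

text \<open>The values come from \<open>value_of K \<sigma>\<close> rather than from
  \<open>\<sigma>\<close>, because a solution may be arbitrary on constant symbols while a
  configuration may not.\<close>

lemma configuration_of_solution: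
  assumes "disjoint_family K" and "is_tfg G" and "well_formed_tfg K G E N\<^sub>1 N\<^sub>2"
    and "solution K E \<sigma>"
  defines "c \<equiv> \<lambda>v. if v \<in> nodes G then Some (value_of K \<sigma> v) else None"
  shows "configuration K G c" and "total_config G c" and "well_defined G c"
proof -
  show "configuration K G c"
    using value_of_const[OF assms(1)] by (auto simp: configuration_def c_def split: if_splits)
  show "total_config G c"
    by (simp add: total_config_def c_def)
  have "the (c v) = (\<Sum>x\<in>X. the (c x))" if "agg_set G v X \<or> red_set G X v" for v X
  proof -
    have "value_of K \<sigma> v = (\<Sum>x\<in>X. value_of K \<sigma> x)"
      using that assms(4) well_formed_tfg_equation_iff[OF assms(3)]
      by (force simp: solution_def)
    also have "\<dots> = (\<Sum>x\<in>X. the (c x))"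
      using agg_or_red_set_nodes(2)[OF assms(2) that] by (intro sum.cong) (auto simp: c_def)
    finally show ?thesis
      using agg_or_red_set_nodes(1)[OF assms(2) that] by (simp add: c_def)
  qed
  \<comment> \<open>This gives (CBot): both ends of an arc are nodes, where \<open>c\<close> is
    defined.\<close>
  moreover have "v \<in> nodes G \<and> w \<in> nodes G" if "(v, w) \<in> arcs G" for v w
    using that assms(2) by (auto simp: arcs_def is_tfg_def)
  ultimately show "well_defined G c"
    by (auto simp: well_defined_def c_def)
qed

text \<open>Every equation of \<open>E\<close> is a \<open>Sum_Eq\<close>, hence by (T4) read off
  the arcs at some node, where totality makes (CEq) applicable.\<close>

lemma solution_of_configuration:
  assumes "disjoint_family K" and "is_tfg G" and "well_formed_tfg K G E N\<^sub>1 N\<^sub>2"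
    and "linear_system K E"
    and "configuration K G c" and "total_config G c" and "well_defined G c"
  shows "solution K E (\<lambda>v. the (c v))"
  unfolding solution_def
proof
  fix e assume "e \<in> E"
  then obtain v X where e: "e = Sum_Eq v X"
    using assms(4) by (auto simp: linear_system_def)
  with \<open>e \<in> E\<close> have vX: "agg_set G v X \<or> red_set G X v"
    using well_formed_tfg_equation_iff[OF assms(3)] by blast
  note nodes = agg_or_red_set_nodes[OF assms(2) vX]
  note val = value_of_configuration[OF assms(1,5)]
  have "the (c v) = (\<Sum>x\<in>X. the (c x))"
    using assms(6,7) vX nodes(1) by (auto simp: total_config_def well_defined_def)
  also have "\<dots> = (\<Sum>x\<in>X. value_of K (\<lambda>v. the (c v)) x)"
    using nodes(2) val by (intro sum.cong) auto
  finally show "satisfies K (\<lambda>v. the (c v)) e"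
    using val[OF nodes(1)] by (simp add: e)
qed

text \<open>Stated for any \<open>P\<close> so that it serves the places of both nets.\<close>

lemma solution_restricted_configuration:
  assumes "disjoint_family K" and "configuration K G c"
  shows "solution K \<lbrakk>c |` P\<rbrakk> (\<lambda>v. the (c v))"
proof -
  have "value_of K (\<lambda>v. the (c v)) x = n" if "(c |` P) x = Some n" for x n
  proof -
    have "c x = Some n"
      using that by (auto simp: restrict_map_def split: if_splits)
    moreover from this have "x \<in> nodes G"
      using assms(2) by (auto simp: configuration_def)
    ultimately show ?thesis
      using value_of_configuration[OF assms] by simp
  qed
  then show ?thesis
    by (simp add: solution_map_system)
qed

lemma marking_restrict_total_config:
  assumes "total_config G c" and "places N \<subseteq> nodes G"
  shows "marking N (c |` places N)"
  using assms by (auto simp: marking_def total_config_def)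

theorem theorem1:
  fixes K :: "nat \<Rightarrow> 'v set"
    and N\<^sub>1 :: "('v, 's) petri_net" and N\<^sub>2 :: "('v, 't) petri_net"
    and m\<^sub>1 m\<^sub>2 :: "'v \<rightharpoonup> nat"
    and E :: "'v equation set" and G :: "'v tfg"
  assumes "disjoint_family K"
    and "is_petri_net N\<^sub>1" and "places N\<^sub>1 \<inter> consts_of K = {}" and "marking N\<^sub>1 m\<^sub>1"
    and "is_petri_net N\<^sub>2" and "places N\<^sub>2 \<inter> consts_of K = {}" and "marking N\<^sub>2 m\<^sub>2"
    and "linear_system K E"
    and "E_equivalent K E N\<^sub>1 m\<^sub>1 N\<^sub>2 m\<^sub>2"
    and "is_tfg G" and "well_formed_tfg K G E N\<^sub>1 N\<^sub>2"
  shows "(\<forall>m. m \<in> reach N\<^sub>1 m\<^sub>1 \<or> m \<in> reach N\<^sub>2 m\<^sub>2 \<longrightarrow>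
            (\<exists>c. configuration K G c \<and> total_config G c \<and> well_defined G c \<and> compatible c m)) \<and>
         (\<forall>c. configuration K G c \<and> total_config G c \<and> well_defined G c \<and>
            c |` places N\<^sub>1 \<in> reach N\<^sub>1 m\<^sub>1 \<longrightarrow> c |` places N\<^sub>2 \<in> reach N\<^sub>2 m\<^sub>2)"
proof (intro conjI allI impI)
  fix m
  assume "m \<in> reach N\<^sub>1 m\<^sub>1 \<or> m \<in> reach N\<^sub>2 m\<^sub>2"
  then have "consistent K (E \<union> \<lbrakk>m\<rbrakk>)"
    using assms(9) by (auto simp: E_equivalent_def)
  then obtain \<sigma> where \<sigma>: "solution K E \<sigma>" "solution K \<lbrakk>m\<rbrakk> \<sigma>"
    by (auto simp: consistent_def solution_Un)
  define c where "c = (\<lambda>v. if v \<in> nodes G then Some (value_of K \<sigma> v) else None)"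
  \<comment> \<open>Wherever \<open>m\<close> is defined, its system forces
    \<open>value_of K \<sigma>\<close> to agree with it.\<close>
  have "compatible c m"
    using \<sigma>(2) by (auto simp: compatible_def c_def solution_map_system split: if_splits)
  then show "\<exists>c. configuration K G c \<and> total_config G c \<and> well_defined G c \<and> compatible c m"
    using configuration_of_solution[OF assms(1,10,11) \<sigma>(1)] unfolding c_def by blast
next
  fix c
  assume c: "configuration K G c \<and> total_config G c \<and> well_defined G c \<and>
    c |` places N\<^sub>1 \<in> reach N\<^sub>1 m\<^sub>1"
  \<comment> \<open>A single assignment solves all three systems at once. Its unspecified values
    \<open>the None\<close> lie outside the nodes, and no symbol of these systems does.\<close>
  have "solution K (E \<union> \<lbrakk>c |` places N\<^sub>1\<rbrakk> \<union> \<lbrakk>c |` places N\<^sub>2\<rbrakk>) (\<lambda>v. the (c v))"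
    using c solution_of_configuration[OF assms(1,10,11,8)]
      solution_restricted_configuration[OF assms(1)]
    by (auto simp: solution_Un)
  then have "consistent K (E \<union> \<lbrakk>c |` places N\<^sub>1\<rbrakk> \<union> \<lbrakk>c |` places N\<^sub>2\<rbrakk>)"
    by (auto simp: consistent_def)
  \<comment> \<open>(A3) speaks of markings only, so the domains must be exactly the place sets: by
    (T1) all places are nodes, and \<open>c\<close> is total.\<close>
  moreover have "marking N\<^sub>1 (c |` places N\<^sub>1)" "marking N\<^sub>2 (c |` places N\<^sub>2)"
    using c well_formed_tfg_places[OF assms(11)] by (auto intro: marking_restrict_total_config)
  ultimately show "c |` places N\<^sub>2 \<in> reach N\<^sub>2 m\<^sub>2"
    using c assms(9) by (auto simp: E_equivalent_def)
qed

end
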